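(* Let $n$ be a positive even integer and let $$f(x) = (x - x^2 - x^3)x^{\frac{3^n-1}{2}} - x + x^2 \in \mathbb{F}_{3^n}[x],$$ which is a permutation polynomial of $\mathbb{F}_{3^n}$. Then the inverse of $f(x)$ on $\mathbb{F}_{3^n}$ is $$f^{-1}(x) = x^{3^{n-1}} \left(x^{\frac{3^n-1}{2}} + 1\right) + \left(\sum_{j=0}^{n-1} \sum_{k=0}^{n-1} (-1)^{j+k} x^{\frac{3^j+3^k}{2}}\right) \left(x^{\frac{3^n-1}{2}} - 1\right),$$ that is, $f^{-1}(f(c)) = c$ for every $c \in \mathbb{F}_{3^n}$. Furthermore, the reversed Dickson polynomial $D_{3^n+5}(1,x)$ is a permutation polynomial of $\mathbb{F}_{3^n}$, and its inverse on $\mathbb{F}_{3^n}$ is $D_{3^n+5}^{-1}(1,x) = 1 - f^{-1}(x+1)$.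
   Context: For a prime power $q$, a polynomial $g \in \mathbb{F}_q[x]$ is a permutation polynomial (PP) of $\mathbb{F}_q$ if it induces a bijection of $\mathbb{F}_q$. The inverse of a PP $g$ on $\mathbb{F}_q$ is a polynomial $g^{-1}(x) \in \mathbb{F}_q[x]$ with $g^{-1}(g(c)) = c$ for all $c \in \mathbb{F}_q$; it is unique modulo $x^q - x$. For an integer $m \ge 1$, the $m$-th reversed Dickson polynomial is $$D_m(a,x) = \sum_{i=0}^{\lfloor m/2 \rfloor} \frac{m}{m-i}\binom{m-i}{i} (-1)^i a^{m-2i} x^i,$$ where $\frac{m}{m-i}\binom{m-i}{i}$ is an integer. One has $D_{3^n+5}(1,x) = f(1-x) - 1$. *)

theory Defs
  imports
    "HOL-Computational_Algebra.Polynomial"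
    "HOL-Library.Cardinality"
begin

definition permutation_poly :: "'a::{field,finite} poly \<Rightarrow> bool" where
  "permutation_poly g \<longleftrightarrow> bij (poly g)"

text \<open>
  An inverse of a permutation polynomial is determined only modulo \<open>x^q - x\<close>,
  so being an inverse is a relation between polynomials.
\<close>

definition is_inverse_poly :: "'a::{field,finite} poly \<Rightarrow> 'a poly \<Rightarrow> bool" where
  "is_inverse_poly g h \<longleftrightarrow> (\<forall>c. poly h (poly g c) = c)"

text \<open>
  The integer \<open>m / (m - i) * binomial (m - i) i\<close>; the truncating division is exact
  in the relevant range by \<open>dickson_coeff_exact\<close> below.
\<close>

definition dickson_coeff :: "nat \<Rightarrow> nat \<Rightarrow> nat" where
  "dickson_coeff m i = (m * ((m - i) choose i)) div (m - i)"

lemma dickson_coeff_exact: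
  assumes "1 \<le> m" "i \<le> m div 2"
  shows "(m - i) dvd m * ((m - i) choose i)"
proof (cases i)
  case 0
  then show ?thesis by simp
next
  case (Suc k)
  from assms have "0 < m - i" by auto
  then obtain r where r: "m - i = Suc r" by (cases "m - i") auto
  with assms Suc have m: "m = Suc r + i" by auto
  have "i * (Suc r choose i) = Suc r * (r choose k)"
    using Suc Suc_times_binomial_eq[of r k] by (simp add: mult.commute)
  then have "m * (Suc r choose i) = Suc r * ((Suc r choose i) + (r choose k))"
    unfolding m by (simp add: algebra_simps)
  then show ?thesis unfolding r by (metis dvd_triv_left)
qed

text \<open>
  \<open>D_m(a,x)\<close> as a polynomial in its second argument \<open>x\<close>.
\<close>

definition reversed_dickson :: "nat \<Rightarrow> 'a::comm_ring_1 \<Rightarrow> 'a poly" where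
  "reversed_dickson m a =
     (\<Sum>i = 0..m div 2. smult (of_nat (dickson_coeff m i) * (-1) ^ i * a ^ (m - 2 * i)) ([:0, 1:] ^ i))"

text \<open>
  The numbers \<open>3 ^ n - 1\<close> and \<open>3 ^ j + 3 ^ k\<close> are even, so the divisions in the exponents are exact.
\<close>

definition f_poly :: "nat \<Rightarrow> 'a::field poly" where
  "f_poly n =
     (let x = [:0, 1:] in (x - x ^ 2 - x ^ 3) * x ^ ((3 ^ n - 1) div 2) - x + x ^ 2)"

definition f_inv_poly :: "nat \<Rightarrow> 'a::field poly" where
  "f_inv_poly n =
     (let x = [:0, 1:] in
        x ^ (3 ^ (n - 1)) * (x ^ ((3 ^ n - 1) div 2) + 1)
        + (\<Sum>j = 0..n - 1. \<Sum>k = 0..n - 1. (-1) ^ (j + k) * x ^ ((3 ^ j + 3 ^ k) div 2))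
          * (x ^ ((3 ^ n - 1) div 2) - 1))"

end

theory Submission
  imports Defs "HOL-Computational_Algebra.Primes"
begin

text \<open>
  Write \<open>q = 3 ^ n\<close>, so that \<open>c ^ ((q - 1) div 2)\<close> is the quadratic character of \<open>c\<close>; as \<open>n\<close> is even,
  \<open>-1\<close> is a square. On squares \<open>f\<close> is \<open>c \<mapsto> - c ^ 3\<close>, and on nonsquares it is
  \<open>c \<mapsto> c * (c + 1) ^ 2\<close>; both maps preserve the quadratic character. With
  \<open>W j k = (-1) ^ (j + k) * c ^ ((3 ^ j + 3 ^ k) div 2)\<close>, the \<open>(j, k)\<close> term of the double sum at
  \<open>c * (c + 1) ^ 2\<close> is the mixed second difference of \<open>W\<close> at \<open>(j, k)\<close>, so that sum telescopes.

  For the reversed Dickson polynomial, Waring's formula \<open>D m (1, u * v) = u ^ m + v ^ m\<close> for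
  \<open>u + v = 1\<close> is applied in \<open>F[X]\<close> to \<open>u = -1 - X\<close> and \<open>v = -1 + X\<close>, which is legitimate in
  characteristic 3 and avoids a quadratic extension of \<open>F\<close>.
\<close>

section \<open>Waring's formula for reversed Dickson polynomials\<close>

lemma dickson_coeff_0 [simp]: "m > 0 \<Longrightarrow> dickson_coeff m 0 = 1"
  by (simp add: dickson_coeff_def)

text \<open>Splitting \<open>m = (m - i) + i\<close> and applying the absorption identity cancels
  the division, which makes Pascal's rule applicable.\<close>

lemma dickson_coeff_Suc:
  "dickson_coeff (r + k + 2) (Suc k) = (Suc r choose Suc k) + (r choose k)"
proof -
  have "Suc k * (Suc r choose Suc k) = Suc r * (r choose k)"
    using Suc_times_binomial_eq[of r k] by (simp add: mult.commute)
  then have "(r + k + 2) * (Suc r choose Suc k)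
      = Suc r * ((Suc r choose Suc k) + (r choose k))"
    by (simp add: algebra_simps)
  moreover have "r + k + 2 - Suc k = Suc r" by simp
  ultimately show ?thesis
    unfolding dickson_coeff_def by (metis nonzero_mult_div_cancel_left nat.distinct(1))
qed

text \<open>Lets the sums for different \<open>m\<close> run to a common bound. For
  \<open>m <= i\<close> it rests on truncated subtraction and \<open>x div 0 = 0\<close>.\<close>

lemma dickson_coeff_eq_0: "m < 2 * i \<Longrightarrow> dickson_coeff m i = 0"
  by (cases "m \<le> i") (auto simp: dickson_coeff_def binomial_eq_0)

text \<open>Positivity matters: \<open>dickson_coeff 0 0\<close> is 0, while the recurrence at
  \<open>m = i = 0\<close> would need 2.\<close>

lemma dickson_coeff_rec:
  assumes "m > 0"
  shows "dickson_coeff (m + 2) (Suc i) = dickson_coeff (Suc m) (Suc i) + dickson_coeff m i"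
proof (cases "m \<le> i")
  case True
  with assms show ?thesis by (simp add: dickson_coeff_eq_0)
next
  case False
  then obtain r where r: "m = r + i + 1"
    by (metis Suc_eq_plus1 add.commute less_imp_Suc_add not_le)
  have "dickson_coeff (m + 2) (Suc i) = (Suc (Suc r) choose Suc i) + (Suc r choose i)"
    using dickson_coeff_Suc[of "Suc r" i] by (simp add: r)
  moreover have "dickson_coeff (Suc m) (Suc i) = (Suc r choose Suc i) + (r choose i)"
    using dickson_coeff_Suc[of r i] by (simp add: r)
  moreover have "dickson_coeff m i + (r choose i) = (Suc r choose i) + (Suc r choose i)"
  proof (cases i)
    case 0
    with assms show ?thesis by simp
  next
    case (Suc k)
    then show ?thesis using dickson_coeff_Suc[of r k] by (simp add: r)
  qed
  ultimately show ?thesis by simp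
qed

lemma pcompose_power: "pcompose (p ^ k) q = pcompose p q ^ k"
  for p q :: "'a::comm_semiring_1 poly"
  by (induction k) (simp_all add: pcompose_1 pcompose_mult)

lemma pcompose_reversed_dickson:
  fixes p :: "'a::comm_ring_1 poly"
  assumes "m \<le> N"
  shows "pcompose (reversed_dickson m 1) p
    = (\<Sum>i\<le>N. of_nat (dickson_coeff m i) * (- p) ^ i)"
proof -
  have "pcompose (reversed_dickson m 1) p
      = (\<Sum>i = 0..m div 2. of_nat (dickson_coeff m i) * (- p) ^ i)"
    unfolding reversed_dickson_def pcompose_sum
  proof (rule sum.cong)
    fix i
    have "smult (of_nat d * (-1) ^ i) (p ^ i) = of_nat d * (- p) ^ i" for d
      by (cases "even i") (simp_all add: of_nat_poly)
    then show "pcompose (smult (of_nat (dickson_coeff m i) * (- 1) ^ i * 1 ^ (m - 2 * i))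
        ([:0, 1:] ^ i)) p = of_nat (dickson_coeff m i) * (- p) ^ i"
      by (simp only: pcompose_smult pcompose_power pcompose_pCons) simp
  qed simp
  also have "\<dots> = (\<Sum>i\<le>N. of_nat (dickson_coeff m i) * (- p) ^ i)"
    using assms by (intro sum.mono_neutral_left) (auto simp: dickson_coeff_eq_0)
  finally show ?thesis .
qed

lemma pcompose_reversed_dickson_rec:
  fixes p :: "'a::comm_ring_1 poly"
  assumes "m > 0"
  shows "pcompose (reversed_dickson (m + 2) 1) p
    = pcompose (reversed_dickson (Suc m) 1) p - p * pcompose (reversed_dickson m 1) p"
proof -
  have "pcompose (reversed_dickson (m + 2) 1) p
      = 1 + (\<Sum>i\<le>Suc m. of_nat (dickson_coeff (m + 2) (Suc i)) * (- p) ^ Suc i)"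
    by (subst pcompose_reversed_dickson[of _ "Suc (Suc m)"]) (simp_all add: sum.atMost_Suc_shift del: sum.atMost_Suc)
  also have "\<dots> = 1 + (\<Sum>i\<le>Suc m. of_nat (dickson_coeff (Suc m) (Suc i)) * (- p) ^ Suc i)
      - p * (\<Sum>i\<le>Suc m. of_nat (dickson_coeff m i) * (- p) ^ i)"
  proof -
    have "of_nat (dickson_coeff (m + 2) (Suc i)) * (- p) ^ Suc i
        = of_nat (dickson_coeff (Suc m) (Suc i)) * (- p) ^ Suc i
          - p * (of_nat (dickson_coeff m i) * (- p) ^ i)" for i
      unfolding dickson_coeff_rec[OF assms] by (simp add: algebra_simps)
    then show ?thesis by (simp only: sum_subtractf sum_distrib_left add_diff_eq)
  qed
  also have "1 + (\<Sum>i\<le>Suc m. of_nat (dickson_coeff (Suc m) (Suc i)) * (- p) ^ Suc i)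
      = pcompose (reversed_dickson (Suc m) 1) p"
    by (subst pcompose_reversed_dickson[of _ "Suc (Suc m)"])
      (simp_all add: sum.atMost_Suc_shift del: sum.atMost_Suc)
  also have "(\<Sum>i\<le>Suc m. of_nat (dickson_coeff m i) * (- p) ^ i)
      = pcompose (reversed_dickson m 1) p"
    by (subst pcompose_reversed_dickson[of _ "Suc m"]) simp_all
  finally show ?thesis .
qed

text \<open>As \<open>u\<close> and \<open>v\<close> are roots of T^2 - T + uv, their power sums
  obey the recurrence of the Dickson polynomials, which starts at index 1; hence the two base
  cases.\<close>

lemma waring_reversed_dickson:
  fixes u v :: "'a::comm_ring_1 poly"
  assumes "m > 0" "u + v = 1"
  shows "pcompose (reversed_dickson m 1) (u * v) = u ^ m + v ^ m"
  using assms(1)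
proof (induction m rule: less_induct)
  case (less m)
  have v: "v = 1 - u" using assms(2) by (simp add: algebra_simps)
  consider "m = 1" | "m = 2" | k where "m = k + 2" "k > 0"
    using less.prems by (metis One_nat_def Suc_1 add_2_eq_Suc' gr0_implies_Suc neq0_conv)
  then show ?case
  proof cases
    case 1
    with assms(2) show ?thesis
      by (simp add: pcompose_reversed_dickson[of "Suc 0" "Suc 0"] dickson_coeff_eq_0)
  next
    case 2
    have "dickson_coeff 2 1 = 2" by (simp add: dickson_coeff_def)
    moreover have "{..2::nat} = {0, 1, 2}" by auto
    ultimately have "pcompose (reversed_dickson 2 1) (u * v) = 1 - 2 * (u * v)"
      by (simp add: pcompose_reversed_dickson[of 2 2] dickson_coeff_eq_0)
    with 2 show ?thesis by (simp add: v algebra_simps power2_eq_square)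
  next
    case 3
    then have "pcompose (reversed_dickson m 1) (u * v)
        = (u ^ Suc k + v ^ Suc k) - u * v * (u ^ k + v ^ k)"
      using less.IH[of k] less.IH[of "Suc k"] pcompose_reversed_dickson_rec[of k "u * v"] by simp
    also have "\<dots> = u ^ m + v ^ m"
      by (simp add: 3 v algebra_simps power_add power2_eq_square)
    finally show ?thesis .
  qed
qed

section \<open>Finite fields of characteristic 3\<close>

text \<open>Translation by 1 permutes the ring, so adding 1 to every summand cannot change the
  total.\<close>

lemma of_nat_CARD_eq_0: "of_nat CARD('a) = (0 :: 'a::{ring_1,finite})"
proof -
  have "(\<Sum>x\<in>UNIV. x) = (\<Sum>x\<in>UNIV. x + (1::'a))"
    by (rule sum.reindex_bij_witness[of _ "\<lambda>x. x + 1" "\<lambda>x. x - 1"]) auto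
  then show ?thesis by (simp add: sum.distrib)
qed

text \<open>
  The library has Fermat's little theorem only for the class \<open>finite_field\<close>, to which a type variable of sort
  \<open>{field,finite}\<close> is not known to belong.
\<close>

lemma power_CARD_minus_1:
  fixes x :: "'a::{field,finite}"
  assumes "x \<noteq> 0"
  shows "x ^ (CARD('a) - 1) = 1"
proof -
  have "(\<Prod>y\<in>UNIV-{0}. x * y) = \<Prod>(UNIV - {0})"
    using assms by (intro prod.reindex_bij_witness[of _ "\<lambda>y. y / x" "\<lambda>y. x * y"]) auto
  moreover have "\<Prod>(UNIV - {0::'a}) \<noteq> 0" by simp
  ultimately show ?thesis by (simp add: prod.distrib)
qed

lemma CHAR_eq_3:
  assumes "CARD('a::{field,finite}) = 3 ^ n"
  shows "CHAR('a) = 3"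
proof -
  have "(3 :: 'a) ^ n = 0"
    using of_nat_CARD_eq_0[where 'a = 'a] assms by simp
  then have "of_nat 3 = (0::'a)" by (cases "n = 0") simp_all
  then have "CHAR('a) dvd 3" by (simp only: of_nat_eq_0_iff_char_dvd)
  moreover have "prime (3::nat)" by simp
  ultimately show ?thesis
    by (metis CHAR_not_1' One_nat_def prime_nat_iff)
qed

lemma three_eq_0: "CHAR('a::comm_semiring_1) = 3 \<Longrightarrow> (3::'a) = 0"
  by (metis of_nat_CHAR of_nat_numeral)

lemma power_3_power_add:
  fixes x y :: "'a::comm_semiring_1"
  assumes "CHAR('a) = 3"
  shows "(x + y) ^ 3 ^ j = x ^ 3 ^ j + y ^ 3 ^ j"
  using assms by (intro freshmans_dream'[of _ j]) simp_all

text \<open>Gives that \<open>(3 ^ n - 1) div 2\<close> is even, so -1 has quadratic character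
  1.\<close>

lemma four_dvd_3_power_minus_1:
  assumes "even n"
  shows "4 dvd (3::nat) ^ n - 1"
proof -
  obtain k where "n = 2 * k" using assms by blast
  moreover have "(9::nat) ^ k mod 4 = 1"
    using power_mod[of "9::nat" 4 k] by simp
  ultimately show ?thesis
    using dvd_minus_mod[of 4 "9 ^ k :: nat"] by (simp add: power_mult)
qed

lemma double_sum_mixed_difference:
  fixes W :: "nat \<Rightarrow> nat \<Rightarrow> 'a::ab_group_add"
  shows "(\<Sum>j<m. \<Sum>k<n. W (Suc j) (Suc k) - W (Suc j) k - W j (Suc k) + W j k)
    = W m n - W m 0 - W 0 n + W 0 0"
proof -
  have "(\<Sum>k<n. W (Suc j) (Suc k) - W (Suc j) k - W j (Suc k) + W j k)
      = (W (Suc j) n - W (Suc j) 0) - (W j n - W j 0)" for j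
    by (induction n) (simp_all add: algebra_simps)
  then show ?thesis
    by (simp add: sum_lessThan_telescope[of "\<lambda>j. W j n - W j 0"])
qed

section \<open>The inverse of \<open>f\<close>\<close>

lemma is_inverse_f_inv_poly:
  fixes n :: nat
  assumes "n > 0" "even n" and card: "CARD('a::{field,finite}) = 3 ^ n"
  shows "is_inverse_poly (f_poly n :: 'a poly) (f_inv_poly n)"
  unfolding is_inverse_poly_def
proof
  fix c :: 'a
  define h where "h = ((3::nat) ^ n - 1) div 2"
  define S where "S y = (\<Sum>j<n. \<Sum>k<n. (-1) ^ (j + k) * y ^ ((3 ^ j + 3 ^ k) div 2))" for y :: 'a
  have char: "CHAR('a) = 3" by (rule CHAR_eq_3[OF card])
  have three: "(3::'a) = 0" by (rule three_eq_0[OF char])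
  have "(2::'a) = 3 - 1" by simp
  then have two: "(2::'a) = -1" using three by simp
  have "even h"
    using four_dvd_3_power_minus_1[OF \<open>even n\<close>] by (auto simp: h_def elim!: dvdE)
  have two_h: "2 * h = 3 ^ n - 1"
    using four_dvd_3_power_minus_1[OF \<open>even n\<close>] by (auto simp: h_def elim!: dvdE)
  have f: "poly (f_poly n) y = (y - y\<^sup>2 - y ^ 3) * y ^ h - y + y\<^sup>2" for y :: 'a
    by (simp add: f_poly_def Let_def h_def)
  have "{0..n - 1} = {..<n}" using \<open>n > 0\<close> by auto
  then have g: "poly (f_inv_poly n) y = y ^ 3 ^ (n - 1) * (y ^ h + 1) + S y * (y ^ h - 1)" for y :: 'a
    by (simp add: f_inv_poly_def Let_def h_def S_def poly_sum)
  have frob: "y ^ 3 ^ n = y" for y :: 'a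
  proof (cases "y = 0")
    case False
    then have "y ^ (3 ^ n - 1) = 1" using power_CARD_minus_1[of y] card by simp
    moreover have "(3::nat) ^ n = Suc (3 ^ n - 1)" by simp
    ultimately show ?thesis by (metis mult.right_neutral power_Suc)
  qed simp
  have "y = 0 \<or> y ^ h = 1 \<or> y ^ h = -1" for y :: 'a
  proof (cases "y = 0")
    case False
    then have "y ^ (2 * h) = 1" using power_CARD_minus_1[of y] card two_h by simp
    then show ?thesis
      by (simp add: power_mult mult.commute[of 2] power2_eq_1_iff)
  qed simp
  then consider "c = 0" | "c ^ h = 1" | "c ^ h = -1" by blast
  then show "poly (f_inv_poly n) (poly (f_poly n) c) = c"
  proof cases
    case 1
    \<comment> \<open>Every exponent is at least 1, so no term is \<open>0 ^ 0 = 1\<close>.\<close>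
    have "S 0 = 0"
      unfolding S_def
    proof (intro sum.neutral ballI)
      fix j k :: nat
      have "(3::nat) ^ j > 0" "(3::nat) ^ k > 0" by simp_all
      then have "((3::nat) ^ j + 3 ^ k) div 2 \<noteq> 0" by linarith
      then show "(-1) ^ (j + k) * (0::'a) ^ ((3 ^ j + 3 ^ k) div 2) = 0" by simp
    qed
    with 1 show ?thesis by (simp add: f g)
  next
    case 2
    have "poly (f_poly n) c = - (c ^ 3)" by (simp add: f 2)
    moreover have "(- (c ^ 3)) ^ h = 1"
      using \<open>even h\<close> 2 by (metis power_commutes power_minus_even power_mult power_one mult.commute)
    \<comment> \<open>This exponent undoes cubing because \<open>c ^ 3 ^ n = c\<close>; being odd,
      it keeps the sign.\<close>
    moreover have "(- (c ^ 3)) ^ 3 ^ (n - 1) = - c"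
      using frob[of c] \<open>n > 0\<close> by (simp add: flip: power_mult power_Suc)
    ultimately have "poly (f_inv_poly n) (poly (f_poly n) c) = - c * 2" by (simp add: g)
    also have "\<dots> = c" by (simp add: two)
    finally show ?thesis .
  next
    case 3
    define y where "y = c * (c + 1)\<^sup>2"
    define W where "W j k = (-1) ^ (j + k) * c ^ ((3 ^ j + 3 ^ k) div 2)" for j k :: nat
    have "poly (f_poly n) c = y - 3 * c"
      unfolding f y_def 3 by algebra
    then have fc: "poly (f_poly n) c = y" using three by simp
    have "(-1 :: 'a) ^ h = 1" using \<open>even h\<close> by simp
    moreover have "(1::'a) \<noteq> -1"
      using two by (metis add.right_inverse neg_equal_0_iff_equal one_add_one one_neq_zero)
    \<comment> \<open>If \<open>c = -1\<close>, then \<open>c ^ h = 1\<close>, against the case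
      assumption. So \<open>(c + 1)^2\<close> is a nonzero square and \<open>y\<close> is a
      nonsquare like \<open>c\<close>.\<close>
    ultimately have "c + 1 \<noteq> 0"
      using 3 by (metis eq_neg_iff_add_eq_0)
    then have "((c + 1)\<^sup>2) ^ h = 1"
      using power_CARD_minus_1[of "c + 1"] card two_h by (simp flip: power_mult)
    then have yh: "y ^ h = -1" by (simp add: y_def power_mult_distrib 3)
    have "(-1) ^ (j + k) * y ^ ((3 ^ j + 3 ^ k) div 2)
        = W (Suc j) (Suc k) - W (Suc j) k - W j (Suc k) + W j k" for j k
    proof -
      define e where "e = ((3::nat) ^ j + 3 ^ k) div 2"
      have "even ((3::nat) ^ j + 3 ^ k)" by simp
      then have e: "2 * e = 3 ^ j + 3 ^ k" unfolding e_def by simp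
      have e1: "(3 ^ Suc j + 3 ^ k) div 2 = e + 3 ^ j"
        and e2: "(3 ^ j + 3 ^ Suc k) div 2 = e + 3 ^ k"
        and e3: "(3 ^ Suc j + 3 ^ Suc k) div 2 = e + 3 ^ j + 3 ^ k"
        using e by simp_all
      \<comment> \<open>Since \<open>2 * e = 3 ^ j + 3 ^ k\<close>, the square in \<open>y\<close>
        yields two Frobenius powers of \<open>c + 1\<close>. Expanding them gives four terms, and
        each factor \<open>c ^ 3 ^ j\<close> or \<open>c ^ 3 ^ k\<close> shifts one index of
        \<open>W\<close>.\<close>
      have "y ^ e = c ^ e * (c + 1) ^ (3 ^ j + 3 ^ k)"
        by (simp add: y_def power_mult_distrib flip: e power_mult)
      also have "\<dots> = c ^ e * (c ^ 3 ^ j + 1) * (c ^ 3 ^ k + 1)"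
        by (simp add: power_add power_3_power_add[OF char])
      finally show ?thesis
        unfolding W_def e1 e2 e3 e_def[symmetric]
        by (simp add: power_add algebra_simps)
    qed
    then have "S y = W n n - W n 0 - W 0 n + W 0 0"
      unfolding S_def by (simp add: double_sum_mixed_difference)
    moreover have "W n n = c" "W 0 0 = c" by (simp_all add: W_def frob)
    moreover have "W n 0 = - c" "W 0 n = - c"
    proof -
      \<comment> \<open>The mixed corners have exponent \<open>h + 1\<close>, where the quadratic
        character supplies the minus sign.\<close>
      have "(3::nat) ^ n = Suc (2 * h)" using two_h by simp
      then have "(3 ^ n + 1) div 2 = Suc h" by simp
      then show "W n 0 = - c" "W 0 n = - c"
        using \<open>even n\<close> 3 by (simp_all add: W_def add.commute)
    qed
    ultimately have "S y = c + 3 * c" by simp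
    then have "S y = c" using three by simp
    then have "poly (f_inv_poly n) y = - 2 * c" by (simp add: g yh)
    also have "\<dots> = c" by (simp add: two)
    finally show ?thesis unfolding fc .
  qed
qed

section \<open>The reversed Dickson polynomial\<close>

text \<open>Both sides are compared after substituting X^2: there the argument 1 - X^2 factors as
  \<open>u * v\<close>, and X^(3^n) is X times a power of X^2.\<close>

lemma reversed_dickson_eq_f_poly:
  fixes n :: nat
  assumes "CHAR('a::field) = 3"
  shows "pcompose (reversed_dickson (3 ^ n + 5) 1) [:1, -1:] = (f_poly n - 1 :: 'a poly)"
proof -
  define X where "X = ([:0, 1:] :: 'a poly)"
  define h where "h = ((3::nat) ^ n - 1) div 2"
  have two_h: "3 ^ n = Suc (2 * h)"
    unfolding h_def by (simp add: odd_Suc_minus_one)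
  have char: "CHAR('a poly) = 3" using assms by simp
  have three: "(3 :: 'a poly) = 0" by (rule three_eq_0[OF char])
  have "(- 1 - X) + (- 1 + X) = 1 - 3" by simp
  then have "(- 1 - X) + (- 1 + X) = 1" using three by simp
  then have "pcompose (reversed_dickson (3 ^ n + 5) 1) ((- 1 - X) * (- 1 + X))
      = (- 1 - X) ^ (3 ^ n + 5) + (- 1 + X) ^ (3 ^ n + 5)"
    by (intro waring_reversed_dickson) simp_all
  moreover have "(- 1 + Z) ^ (3 ^ n + 5) = (- 1 + Z * (Z\<^sup>2) ^ h) * (- 1 + Z) ^ 5" for Z :: "'a poly"
  proof -
    have "(- 1 :: 'a poly) ^ 3 ^ n = - 1" by simp
    moreover have "Z ^ 3 ^ n = Z * (Z\<^sup>2) ^ h" by (simp add: two_h power_mult)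
    ultimately show ?thesis unfolding power_add power_3_power_add[OF char] by simp
  qed
  from this[of "- X"] this[of X]
  have "(- 1 - X) ^ (3 ^ n + 5) = (- 1 - X * (X\<^sup>2) ^ h) * (- 1 - X) ^ 5"
    "(- 1 + X) ^ (3 ^ n + 5) = (- 1 + X * (X\<^sup>2) ^ h) * (- 1 + X) ^ 5" by simp_all
  moreover have "(- 1 - X) * (- 1 + X) = pcompose [:1, -1:] (X\<^sup>2)"
    by (simp add: pcompose_pCons one_pCons algebra_simps power2_eq_square)
  moreover have "pcompose (f_poly n) (X\<^sup>2)
      = (X\<^sup>2 - (X\<^sup>2)\<^sup>2 - (X\<^sup>2) ^ 3) * (X\<^sup>2) ^ h - X\<^sup>2 + (X\<^sup>2)\<^sup>2"
    by (simp add: f_poly_def Let_def h_def pcompose_add pcompose_diff pcompose_mult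
        pcompose_power pcompose_pCons)
  moreover have "(- 1 - X * Y) * (- 1 - X) ^ 5 + (- 1 + X * Y) * (- 1 + X) ^ 5
      = (X\<^sup>2 - (X\<^sup>2)\<^sup>2 - (X\<^sup>2) ^ 3) * Y - X\<^sup>2 + (X\<^sup>2)\<^sup>2 - 1" for Y
  proof -
    \<comment> \<open>With \<open>Y\<close> for \<open>(X^2) ^ h\<close>, the two sides differ over
      the integers by an explicit multiple of 3.\<close>
    have "(- 1 - X * Y) * (- 1 - X) ^ 5 + (- 1 + X * Y) * (- 1 + X) ^ 5
        = (X\<^sup>2 - (X\<^sup>2)\<^sup>2 - (X\<^sup>2) ^ 3) * Y - X\<^sup>2 + (X\<^sup>2)\<^sup>2 - 1
          + 3 * (1 + 7 * X\<^sup>2 + 3 * X ^ 4 + Y * (3 * X\<^sup>2 + 7 * X ^ 4 + X ^ 6))"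
      by algebra
    with three show ?thesis by simp
  qed
  ultimately have "pcompose (pcompose (reversed_dickson (3 ^ n + 5) 1) [:1, -1:] - (f_poly n - 1)) (X\<^sup>2)
      = 0"
    by (simp add: pcompose_diff pcompose_1 flip: pcompose_assoc)
  \<comment> \<open>Over a field, composing with a nonconstant polynomial sends only 0 to 0, so the
    substitution can be undone.\<close>
  moreover have "degree (X\<^sup>2) > 0" by (simp add: X_def degree_power_eq)
  ultimately show ?thesis using pcompose_eq_0 by fastforce
qed

text \<open>A left inverse forces injectivity, hence bijectivity on a finite field.\<close>

lemma is_inverse_poly_imp_permutation_poly:
  "is_inverse_poly g h \<Longrightarrow> permutation_poly g"
  unfolding is_inverse_poly_def permutation_poly_def bij_def
  by (metis finite_UNIV_inj_surj finite injI)

theorem theorem1: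
  fixes n :: nat
  assumes "n > 0" and "even n"
    and "CARD('a::{field,finite}) = 3 ^ n"
  shows "permutation_poly (f_poly n :: 'a poly)
       \<and> is_inverse_poly (f_poly n :: 'a poly) (f_inv_poly n)
       \<and> permutation_poly (reversed_dickson (3 ^ n + 5) (1 :: 'a))
       \<and> is_inverse_poly (reversed_dickson (3 ^ n + 5) (1 :: 'a))
            (1 - pcompose (f_inv_poly n) [:1, 1:])"
proof -
  have f: "is_inverse_poly (f_poly n :: 'a poly) (f_inv_poly n)"
    by (rule is_inverse_f_inv_poly[OF assms])
  \<comment> \<open>Evaluating at \<open>1 - c\<close> cancels the inner reflection; then
    \<open>f_inv_poly\<close> at \<open>f(1 - c)\<close> returns \<open>1 - c\<close>.\<close>
  have "poly (reversed_dickson (3 ^ n + 5) 1) c = poly (f_poly n) (1 - c) - 1" for c :: 'a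
    using arg_cong[OF reversed_dickson_eq_f_poly[OF CHAR_eq_3[OF assms(3)]],
        of "\<lambda>p. poly p (1 - c)"]
    by (simp add: poly_pcompose)
  then have "is_inverse_poly (reversed_dickson (3 ^ n + 5) (1 :: 'a))
      (1 - pcompose (f_inv_poly n) [:1, 1:])"
    using f by (simp add: is_inverse_poly_def poly_pcompose)
  with f show ?thesis
    by (blast intro: is_inverse_poly_imp_permutation_poly)
qed

end
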